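(* Work over $\mathbb{Z}[a,q]$. For $0\leq i\leq n$ let $g_i(x)=\sum_{k=0}^iA_{ik}a^kx^k$ with $A_{ik}\in\mathbb{Z}[a,q]$ and $A_{ii}=1$. Then the matrix $(g_i([j]_q))_{0\leq i,j\leq n}$ has special Smith normal form $\mathrm{diag}\big(1,a^1q^{\binom12}[1]!_q,a^2q^{\binom22}[2]!_q,\ldots,a^nq^{\binom n2}[n]!_q\big)$ over $\mathbb{Z}[a,q]$. In particular: (a) over $\mathbb{Z}[a,q]$ the matrix $\big((1+a[j]_q)^i\big)_{0\leq i,j\leq n}$ has special Smith normal form $\mathrm{diag}\big(1,a^1q^{\binom12}[1]!_q,\ldots,a^nq^{\binom n2}[n]!_q\big)$; (b) over $\mathbb{Z}[q]$ the matrix $\big([j+1]_q^i\big)_{0\leq i,j\leq n}$ has special Smith normal form $\mathrm{diag}\big(1,q^{\binom22}[1]!_q,q^{\binom32}[2]!_q,\ldots,q^{\binom{n+1}2}[n]!_q\big)$.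
   Context: $[j]_q=1+q+\cdots+q^{j-1}$ (so $[0]_q=0$), $[k]!_q=[1]_q[2]_q\cdots[k]_q$ with $[0]!_q=1$. For an $m\times n$ matrix $A$ over a commutative ring $R$, a matrix $D$ is a special Smith normal form (SSNF) of $A$ over $R$ if there exist $P\in \mathrm{SL}(m,R)$, $Q\in\mathrm{SL}(n,R)$ with $PAQ=D$, $D$ is diagonal, and $d_{ii}$ is a multiple in $R$ of $d_{jj}$ whenever $i\geq j$. *)

theory Defs
  imports "HOL-Computational_Algebra.Polynomial" "Jordan_Normal_Form.Determinant"
begin

definition q_num :: "'a :: comm_ring_1 \<Rightarrow> nat \<Rightarrow> 'a" where
  "q_num q j = (\<Sum>i<j. q ^ i)"

definition q_fact :: "'a :: comm_ring_1 \<Rightarrow> nat \<Rightarrow> 'a" where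
  "q_fact q k = (\<Prod>i\<in>{1..k}. q_num q i)"

definition SL :: "nat \<Rightarrow> 'a :: comm_ring_1 mat set" where
  "SL n = {P \<in> carrier_mat n n. det P = 1}"

text \<open>The ring is the element type. The matrix may be rectangular, so the
  divisibility condition only concerns indices below both dimensions.\<close>

definition is_SSNF :: "'a :: comm_ring_1 mat \<Rightarrow> 'a mat \<Rightarrow> bool" where
  "is_SSNF A D \<longleftrightarrow>
     (\<exists>P \<in> SL (dim_row A). \<exists>Q \<in> SL (dim_col A). P * A * Q = D) \<and>
     diagonal_mat D \<and>
     (\<forall>i j. j \<le> i \<and> i < min (dim_row D) (dim_col D) \<longrightarrow> D $$ (j, j) dvd D $$ (i, i))"

text \<open>The polynomial ring in a and q over the integers is modelled as polynomials in a
  whose coefficients are integer polynomials in q, i.e. by the type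
  \<^typ>\<open>int poly poly\<close>; \<open>var_q1\<close> is q itself in the coefficient ring.\<close>

definition var_a :: "int poly poly" where
  "var_a = [:0, 1:]"

definition var_q :: "int poly poly" where
  "var_q = [:[:0, 1:]:]"

definition var_q1 :: "int poly" where
  "var_q1 = [:0, 1:]"

end

theory Submission imports Defs begin

text \<open>Expand the powers of \<open>x\<close> in the Newton basis \<open>\<Prod>i<l. (x - [i]\<^sub>q)\<close>, whose value at
  \<open>[j]\<^sub>q\<close> is \<open>q ^ (l choose 2) * [l]!\<^sub>q\<close> times a Gaussian binomial coefficient. This factors the
  matrix as \<open>B * D * U\<close> with \<open>D\<close> the asserted diagonal, \<open>B\<close> lower and \<open>U\<close> upper unitriangular,
  and unitriangular matrices are inverted by their adjugates. Part (a) is the case of binomial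
  coefficients; part (b) then follows by setting \<open>a = q\<close>, because \<open>[j + 1]\<^sub>q = 1 + q * [j]\<^sub>q\<close>.\<close>

lemma SL_inverse:
  assumes "B \<in> SL n"
  obtains P where "P \<in> SL n" "P * B = 1\<^sub>m n" "B * P = 1\<^sub>m n"
proof -
  have B: "B \<in> carrier_mat n n" "det B = 1"
    using assms by (auto simp: SL_def)
  note adj = adj_mat[OF B(1)]
  have inv: "adj_mat B * B = 1\<^sub>m n" "B * adj_mat B = 1\<^sub>m n"
    using adj B(2) by auto
  have "det (adj_mat B) * det B = 1"
    using det_mult[OF adj(1) B(1)] inv(1) by simp
  with B adj inv show thesis
    by (intro that[of "adj_mat B"]) (auto simp: SL_def)
qed

text \<open>The inverses of \<open>B\<close> and \<open>U\<close> again have determinant 1 and serve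
  as the two transforming matrices, so a factorization through \<open>D\<close> suffices.\<close>

lemma is_SSNF_SL_mult:
  assumes B: "B \<in> SL n" and U: "U \<in> SL n" and D: "D \<in> carrier_mat n n" "diagonal_mat D"
    and dvd: "\<And>i j. j \<le> i \<Longrightarrow> i < n \<Longrightarrow> D $$ (j, j) dvd D $$ (i, i)"
  shows "is_SSNF (B * D * U) D"
proof -
  have c: "B \<in> carrier_mat n n" "U \<in> carrier_mat n n"
    using B U by (auto simp: SL_def)
  obtain P where P: "P \<in> SL n" "P * B = 1\<^sub>m n"
    using SL_inverse[OF B] .
  obtain Q where Q: "Q \<in> SL n" "U * Q = 1\<^sub>m n"
    using SL_inverse[OF U] .
  have c': "P \<in> carrier_mat n n" "Q \<in> carrier_mat n n"
    using P Q by (auto simp: SL_def)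
  have "P * (B * D * U) * Q = (P * B) * D * (U * Q)"
    using c c' D(1) by (simp add: assoc_mult_mat[of _ n n _ n _ n])
  also have "\<dots> = D"
    using P Q D(1) by simp
  finally show ?thesis
    using P(1) Q(1) c D dvd unfolding is_SSNF_def by auto
qed

lemma lower_unitriangular_SL:
  assumes "\<And>i j. i < j \<Longrightarrow> j < n \<Longrightarrow> f i j = 0" and "\<And>i. i < n \<Longrightarrow> f i i = 1"
  shows "mat n n (\<lambda>(i, j). f i j) \<in> SL n"
proof -
  have "prod_list (diag_mat (mat n n (\<lambda>(i, j). f i j))) = 1"
    unfolding prod_list_diag_prod using assms(2) by (auto intro!: prod.neutral)
  then show ?thesis
    using assms(1) by (subst SL_def) (simp add: det_lower_triangular[where n = n])
qed

lemma upper_unitriangular_SL: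
  assumes "\<And>i j. j < i \<Longrightarrow> i < n \<Longrightarrow> f i j = 0" and "\<And>i. i < n \<Longrightarrow> f i i = 1"
  shows "mat n n (\<lambda>(i, j). f i j) \<in> SL n"
proof -
  have "prod_list (diag_mat (mat n n (\<lambda>(i, j). f i j))) = 1"
    unfolding prod_list_diag_prod using assms(2) by (auto intro!: prod.neutral)
  then show ?thesis
    using assms(1)
    by (subst SL_def) (simp add: det_upper_triangular[where n = n] upper_triangular_def)
qed

lemma q_num_Suc: "q_num q (Suc j) = 1 + q * q_num q j"
  by (simp add: q_num_def sum.lessThan_Suc_shift sum_distrib_left del: sum.lessThan_Suc)

lemma q_fact_Suc: "q_fact q (Suc k) = q_fact q k * q_num q (Suc k)"
  by (simp add: q_fact_def)

lemma q_fact_dvd: "j \<le> i \<Longrightarrow> q_fact q j dvd q_fact q i"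
  unfolding q_fact_def by (intro prod_dvd_prod_subset) auto

definition newton_prod :: "'a :: comm_ring_1 \<Rightarrow> nat \<Rightarrow> 'a \<Rightarrow> 'a" where
  "newton_prod q l x = (\<Prod>i<l. x - q_num q i)"

text \<open>Gaussian binomial coefficient, given by a q-Pascal recurrence because quotients of
  q-factorials need not make sense in an arbitrary commutative ring.\<close>

fun q_binomial :: "'a :: comm_ring_1 \<Rightarrow> nat \<Rightarrow> nat \<Rightarrow> 'a" where
  "q_binomial q j 0 = 1"
| "q_binomial q 0 (Suc l) = 0"
| "q_binomial q (Suc j) (Suc l) = q_binomial q j l + q ^ Suc l * q_binomial q j (Suc l)"

text \<open>q-Stirling numbers of the second kind, the coefficients of \<open>x ^ k\<close> in the
  Newton basis.\<close>

fun q_stirling :: "'a :: comm_ring_1 \<Rightarrow> nat \<Rightarrow> nat \<Rightarrow> 'a" where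
  "q_stirling q 0 l = (if l = 0 then 1 else 0)"
| "q_stirling q (Suc k) 0 = 0"
| "q_stirling q (Suc k) (Suc l) = q_stirling q k l + q_num q (Suc l) * q_stirling q k (Suc l)"

lemma q_binomial_eq_0: "j < l \<Longrightarrow> q_binomial q j l = 0"
  by (induction q j l rule: q_binomial.induct) auto

lemma q_binomial_self: "q_binomial q j j = 1"
  by (induction j) (auto simp: q_binomial_eq_0)

lemma q_stirling_eq_0: "k < l \<Longrightarrow> q_stirling q k l = 0"
  by (induction q k l rule: q_stirling.induct) auto

lemma q_stirling_self: "q_stirling q k k = 1"
  by (induction k) (auto simp: q_stirling_eq_0)

lemma newton_prod_Suc: "newton_prod q (Suc l) x = newton_prod q l x * (x - q_num q l)"
  by (simp add: newton_prod_def)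

text \<open>The factor for \<open>i = 0\<close> is \<open>q_num q (Suc j)\<close> itself since
  \<open>q_num q 0 = 0\<close>. Each of the other \<open>l\<close> factors yields one
  \<open>q\<close>, because \<open>[j+1]_q - [i+1]_q = q * ([j]_q - [i]_q)\<close>.\<close>

lemma newton_prod_q_num_Suc:
  "newton_prod q (Suc l) (q_num q (Suc j)) = q_num q (Suc j) * q ^ l * newton_prod q l (q_num q j)"
proof -
  have "newton_prod q (Suc l) (q_num q (Suc j)) =
      q_num q (Suc j) * (\<Prod>i<l. q_num q (Suc j) - q_num q (Suc i))"
    unfolding newton_prod_def prod.lessThan_Suc_shift by (simp add: q_num_def)
  also have "(\<Prod>i<l. q_num q (Suc j) - q_num q (Suc i)) = (\<Prod>i<l. q * (q_num q j - q_num q i))"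
    by (simp add: q_num_Suc algebra_simps)
  finally show ?thesis
    by (simp add: newton_prod_def prod.distrib mult.assoc)
qed

lemma newton_prod_q_num:
  "newton_prod q l (q_num q j) = q ^ (l choose 2) * q_fact q l * q_binomial q j l"
proof (induction q j l rule: q_binomial.induct)
  case (1 q j)
  show ?case by (simp add: newton_prod_def q_fact_def numeral_2_eq_2)
next
  case (2 q l)
  show ?case by (simp add: newton_prod_def prod.lessThan_Suc_shift q_num_def del: prod.lessThan_Suc)
next
  case (3 q j l)
  let ?N = "newton_prod q l (q_num q j)"
  have ch: "Suc l choose 2 = l + (l choose 2)"
    by (simp add: numeral_2_eq_2)
  have "q ^ (Suc l choose 2) * q_fact q (Suc l) * q_binomial q (Suc j) (Suc l) =
      q_num q (Suc l) * q ^ l * (q ^ (l choose 2) * q_fact q l * q_binomial q j l)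
      + q ^ Suc l * (q ^ (Suc l choose 2) * q_fact q (Suc l) * q_binomial q j (Suc l))"
    by (simp add: ch q_fact_Suc power_add algebra_simps)
  also have "\<dots> = q_num q (Suc l) * q ^ l * ?N + q ^ Suc l * newton_prod q (Suc l) (q_num q j)"
    by (simp only: 3)
  \<comment> \<open>After \<open>q ^ l * ?N\<close> is factored out, what remains is
    \<open>[l+1]_q + q * ([j]_q - [l]_q) = 1 + q * [j]_q = [j+1]_q\<close>.\<close>
  also have "\<dots> = newton_prod q (Suc l) (q_num q (Suc j))"
    unfolding newton_prod_q_num_Suc newton_prod_Suc[of q l "q_num q j"]
    by (simp add: q_num_Suc algebra_simps)
  finally show ?case by simp
qed

text \<open>Writing \<open>x = (x - [l]_q) + [l]_q\<close> shows that multiplication by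
  \<open>x\<close> sends the basis element of index \<open>l\<close> to the next one plus
  \<open>[l]_q\<close> times itself, which is the recurrence of \<open>q_stirling\<close>.\<close>

lemma power_newton_prod:
  "x ^ k = (\<Sum>l\<le>k. q_stirling q k l * newton_prod q l x)"
proof (induction k)
  case 0
  show ?case by (simp add: newton_prod_def)
next
  case (Suc k)
  let ?S = "q_stirling q" and ?N = "\<lambda>l. newton_prod q l x"
  \<comment> \<open>The index moves by one at no cost: the term for \<open>l = 0\<close> vanishes by
    \<open>[0]_q = 0\<close>, the added term for \<open>l = Suc k\<close> by
    \<open>q_stirling q k (Suc k) = 0\<close>.\<close>
  have shift: "(\<Sum>l\<le>k. ?S k l * (q_num q l * ?N l))
      = (\<Sum>l\<le>k. q_num q (Suc l) * ?S k (Suc l) * ?N (Suc l))" (is "?L = _")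
  proof -
    have "?L = (\<Sum>l\<le>Suc k. ?S k l * (q_num q l * ?N l))"
      by (simp add: q_stirling_eq_0)
    also have "\<dots> = (\<Sum>l\<le>k. ?S k (Suc l) * (q_num q (Suc l) * ?N (Suc l)))"
      unfolding sum.atMost_Suc_shift by (simp add: q_num_def)
    finally show ?thesis by (simp add: mult_ac)
  qed
  have "x ^ Suc k = (\<Sum>l\<le>k. ?S k l * (x * ?N l))"
    using Suc by (simp add: sum_distrib_left mult_ac)
  also have "\<dots> = (\<Sum>l\<le>k. ?S k l * ?N (Suc l)) + (\<Sum>l\<le>k. ?S k l * (q_num q l * ?N l))"
    by (simp add: newton_prod_Suc algebra_simps flip: sum.distrib)
  also have "\<dots> = (\<Sum>l\<le>k. ?S (Suc k) (Suc l) * ?N (Suc l))"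
    unfolding shift by (simp add: algebra_simps sum.distrib)
  also have "\<dots> = (\<Sum>l\<le>Suc k. ?S (Suc k) l * ?N l)"
    unfolding sum.atMost_Suc_shift by simp
  finally show ?case .
qed

text \<open>Here \<open>a\<close> and \<open>q\<close> are arbitrary ring elements rather than
  indeterminates, which later permits the specialization \<open>a = q\<close>.\<close>

lemma is_SSNF_q_num_polys:
  fixes a q :: "'a :: comm_ring_1"
  assumes A: "\<And>i. i \<le> n \<Longrightarrow> A i i = 1"
  shows "is_SSNF (mat (n + 1) (n + 1) (\<lambda>(i, j). \<Sum>k\<le>i. A i k * a ^ k * q_num q j ^ k))
           (mat_diag (n + 1) (\<lambda>i. a ^ i * q ^ (i choose 2) * q_fact q i))"
proof -
  \<comment> \<open>\<open>b i l\<close> collects the coefficient of \<open>a ^ l\<close> times the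
    \<open>l\<close>-th Newton polynomial in row \<open>i\<close>. The range
    \<open>k \<ge> l\<close> makes \<open>k - l\<close> a true difference, and it is empty for
    \<open>l > i\<close>, so \<open>B\<close> is lower triangular.\<close>
  define b where "b i l = (\<Sum>k=l..i. A i k * a ^ (k - l) * q_stirling q k l)" for i l
  define d where "d i = a ^ i * q ^ (i choose 2) * q_fact q i" for i
  define B where "B = mat (n + 1) (n + 1) (\<lambda>(i, l). b i l)"
  define U where "U = mat (n + 1) (n + 1) (\<lambda>(l, j). q_binomial q j l)"
  have B: "B \<in> SL (n + 1)"
    unfolding B_def by (rule lower_unitriangular_SL) (auto simp: b_def A q_stirling_self)
  have U: "U \<in> SL (n + 1)"
    unfolding U_def
    by (rule upper_unitriangular_SL) (auto simp: q_binomial_eq_0 q_binomial_self)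
  have entry: "(\<Sum>k\<le>i. A i k * a ^ k * q_num q j ^ k) = (\<Sum>l\<le>n. b i l * d l * q_binomial q j l)"
    if "i \<le> n" for i j
  proof -
    let ?N = "\<lambda>l. newton_prod q l (q_num q j)"
    have "(\<Sum>k\<le>i. A i k * a ^ k * q_num q j ^ k)
        = (\<Sum>k\<le>i. \<Sum>l\<le>k. A i k * a ^ k * q_stirling q k l * ?N l)"
      by (subst power_newton_prod[of _ _ q]) (simp add: sum_distrib_left mult_ac)
    \<comment> \<open>Both double sums run over the triangle \<open>l \<le> k \<le> i\<close>;
      swapping the pairs matches them.\<close>
    also have "\<dots> = (\<Sum>l\<le>i. \<Sum>k=l..i. A i k * a ^ k * q_stirling q k l * ?N l)"
      by (simp add: sum.Sigma) (rule sum.reindex_bij_witness[of _ prod.swap prod.swap]; auto)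
    also have "\<dots> = (\<Sum>l\<le>i. \<Sum>k=l..i. A i k * a ^ (k - l) * q_stirling q k l * (a ^ l * ?N l))"
    proof (intro sum.cong refl)
      fix l k assume "k \<in> {l..i}"
      then have "a ^ k = a ^ (k - l) * a ^ l"
        by (simp flip: power_add)
      then show "A i k * a ^ k * q_stirling q k l * ?N l
          = A i k * a ^ (k - l) * q_stirling q k l * (a ^ l * ?N l)"
        by (simp add: mult_ac)
    qed
    also have "\<dots> = (\<Sum>l\<le>i. b i l * d l * q_binomial q j l)"
      by (simp add: b_def d_def newton_prod_q_num sum_distrib_left sum_distrib_right mult_ac)
    also have "\<dots> = (\<Sum>l\<le>n. b i l * d l * q_binomial q j l)"
      using that by (intro sum.mono_neutral_left) (auto simp: b_def)
    finally show ?thesis .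
  qed
  have "mat (n + 1) (n + 1) (\<lambda>(i, j). \<Sum>k\<le>i. A i k * a ^ k * q_num q j ^ k)
      = B * mat_diag (n + 1) d * U"
    \<comment> \<open>Multiplying by the diagonal matrix on the right scales column \<open>l\<close>
      of \<open>B\<close> by \<open>d l\<close>, so the entries of the triple product are the sums
      in \<open>entry\<close>.\<close>
    by (rule eq_matI)
       (auto simp: B_def U_def mat_diag_mult_right[where n = "Suc n" and nr = "Suc n"]
          scalar_prod_def entry atLeast0LessThan lessThan_Suc_atMost simp del: sum.lessThan_Suc)
  moreover have "is_SSNF (B * mat_diag (n + 1) d * U) (mat_diag (n + 1) d)"
  proof (rule is_SSNF_SL_mult[OF B U])
    fix i j assume "j \<le> i" "i < n + 1"
    moreover from \<open>j \<le> i\<close> have "d j dvd d i"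
      unfolding d_def
      by (intro mult_dvd_mono le_imp_power_dvd q_fact_dvd) (auto simp: choose_two intro!: div_le_mono mult_le_mono)
    ultimately show "mat_diag (n + 1) d $$ (j, j) dvd mat_diag (n + 1) d $$ (i, i)"
      by (simp add: mat_diag_def)
  qed (auto simp: mat_diag_def diagonal_mat_def)
  ultimately show ?thesis
    by (simp add: d_def[abs_def])
qed

lemma is_SSNF_q_num_powers:
  fixes a q :: "'a :: comm_ring_1"
  shows "is_SSNF (mat (n + 1) (n + 1) (\<lambda>(i, j). (1 + a * q_num q j) ^ i))
           (mat_diag (n + 1) (\<lambda>i. a ^ i * q ^ (i choose 2) * q_fact q i))"
proof -
  have "(1 + a * q_num q j) ^ i = (\<Sum>k\<le>i. of_nat (i choose k) * a ^ k * q_num q j ^ k)" for i j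
    using binomial_ring[of "a * q_num q j" 1 i]
    by (simp add: add.commute power_mult_distrib mult.assoc)
  then show ?thesis
    using is_SSNF_q_num_polys[of n "\<lambda>i k. of_nat (i choose k)" a q] by simp
qed

theorem theorem7p1:
  fixes n :: nat
  shows "(\<forall>(A :: nat \<Rightarrow> nat \<Rightarrow> int poly poly) (g :: nat \<Rightarrow> int poly poly \<Rightarrow> int poly poly).
            (\<forall>i\<le>n. A i i = 1) \<and>
            (\<forall>i\<le>n. \<forall>x. g i x = (\<Sum>k=0..i. A i k * var_a ^ k * x ^ k)) \<longrightarrow>
            is_SSNF (mat (n + 1) (n + 1) (\<lambda>(i, j). g i (q_num var_q j)))
              (mat_diag (n + 1) (\<lambda>i. var_a ^ i * var_q ^ (i choose 2) * q_fact var_q i)))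
       \<and> is_SSNF (mat (n + 1) (n + 1) (\<lambda>(i, j). (1 + var_a * q_num var_q j) ^ i))
              (mat_diag (n + 1) (\<lambda>i. var_a ^ i * var_q ^ (i choose 2) * q_fact var_q i))
       \<and> is_SSNF (mat (n + 1) (n + 1) (\<lambda>(i, j). q_num var_q1 (j + 1) ^ i))
              (mat_diag (n + 1) (\<lambda>i. var_q1 ^ ((i + 1) choose 2) * q_fact var_q1 i))"
proof (intro conjI allI impI)
  fix A :: "nat \<Rightarrow> nat \<Rightarrow> int poly poly" and g :: "nat \<Rightarrow> int poly poly \<Rightarrow> int poly poly"
  assume *: "(\<forall>i\<le>n. A i i = 1) \<and>
    (\<forall>i\<le>n. \<forall>x. g i x = (\<Sum>k=0..i. A i k * var_a ^ k * x ^ k))"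
  then have "mat (n + 1) (n + 1) (\<lambda>(i, j). g i (q_num var_q j)) =
      mat (n + 1) (n + 1) (\<lambda>(i, j). \<Sum>k\<le>i. A i k * var_a ^ k * q_num var_q j ^ k)"
    by (intro eq_matI) (auto simp: atLeast0AtMost)
  then show "is_SSNF (mat (n + 1) (n + 1) (\<lambda>(i, j). g i (q_num var_q j)))
      (mat_diag (n + 1) (\<lambda>i. var_a ^ i * var_q ^ (i choose 2) * q_fact var_q i))"
    using is_SSNF_q_num_polys[of n A var_a var_q] * by simp
next
  show "is_SSNF (mat (n + 1) (n + 1) (\<lambda>(i, j). (1 + var_a * q_num var_q j) ^ i))
      (mat_diag (n + 1) (\<lambda>i. var_a ^ i * var_q ^ (i choose 2) * q_fact var_q i))"
    by (rule is_SSNF_q_num_powers)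
next
  \<comment> \<open>With \<open>a = q\<close> the factor \<open>a ^ i\<close> is absorbed by
    Pascal's rule: \<open>i\<close> plus \<open>i choose 2\<close> is
    \<open>(i + 1) choose 2\<close>.\<close>
  have "var_q1 ^ ((i + 1) choose 2) = var_q1 ^ i * var_q1 ^ (i choose 2)" for i
    by (simp add: numeral_2_eq_2 power_add)
  then show "is_SSNF (mat (n + 1) (n + 1) (\<lambda>(i, j). q_num var_q1 (j + 1) ^ i))
      (mat_diag (n + 1) (\<lambda>i. var_q1 ^ ((i + 1) choose 2) * q_fact var_q1 i))"
    using is_SSNF_q_num_powers[of n var_q1 var_q1] by (simp add: q_num_Suc)
qed

end
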